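(* For every graph $H$, integer $k\ge 1$, and family of graphs $\mathcal{F}$, either $\mathrm{ex}(n,H,\mathcal{F})=\Omega_{H,k}(n^k)$ or there exists a positive integer $q$ such that every $\mathcal{F}$-free graph is also $\mathcal{F}_{H,k}^q$-free. In particular, either $\mathrm{ex}(n,H,\mathcal{F})=\Omega_{H,k}(n^k)$ or there exists a positive integer $q$ such that $\mathrm{ex}(n,H,\mathcal{F})\le \mathrm{ex}(n,H,\mathcal{F}_{H,k}^q)$ for all $n$.
   Context: Graphs are finite and simple. A graph is $\mathcal{F}$-free, for a family of graphs $\mathcal{F}$, if it contains no (not necessarily induced) subgraph isomorphic to a member of $\mathcal{F}$. $\mathrm{ex}(n,H,\mathcal{F})$ is the maximum number of copies of $H$ (subgraphs isomorphic to $H$) that an $n$-vertex $\mathcal{F}$-free graph can have, with the convention that it is $0$ if there is no $\mathcal{F}$-free graph on $n$ vertices. Given a graph $H$, a set $R\subseteq V(H)$, and a positive integer $q$, $H_R^q$ is the graph obtained by taking the union of $q$ copies of $H$ such that all copies agree on the set of vertices $R$ and are otherwise disjoint. For each integer $k\ge 1$, $\mathcal{F}_{H,k}^q:=\{H_R^q: R\subsetneq V(H),\ H-R \text{ has at least } k \text{ connected components}\}$. Asymptotics are as $n\to\infty$; subscripts on $\Omega$ indicate what the implied constant may depend on. *)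

theory Defs
  imports
    Complex_Main
    "Graph_Theory.Digraph_Component"
    "Graph_Theory.Digraph_Isomorphism"
begin

text \<open>
  A finite simple graph is a \<^locale>\<open>pair_graph\<close>: a finite set of vertices together with a
  symmetric, irreflexive set of arcs, every edge being represented by its two orientations.
\<close>

text \<open>
  The copies of \<open>H\<close> in \<open>G\<close> are the (not necessarily induced) subgraphs of \<open>G\<close> isomorphic to \<open>H\<close>;
  they are counted as subgraphs, not as embeddings.
\<close>

definition copies :: "'a pair_pre_digraph \<Rightarrow> 'b pair_pre_digraph \<Rightarrow> 'b pair_pre_digraph set" where
  "copies H G =
     {K. pair_graph K \<and> subgraph (with_proj K) (with_proj G) \<and>
         digraph_iso (with_proj H) (with_proj K)}"

definition family_free :: "'a pair_pre_digraph set \<Rightarrow> 'b pair_pre_digraph \<Rightarrow> bool" where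
  "family_free \<F> G \<longleftrightarrow> (\<forall>F\<in>\<F>. copies F G = {})"

text \<open>
  Vertices are natural numbers without loss of generality, all graphs being finite.
  For fixed \<open>n\<close> the counts below are bounded, so the maximum is over a finite set; the additional
  element \<open>0\<close> only matters if there is no \<open>\<F>\<close>-free graph on \<open>n\<close> vertices.
\<close>

definition ex_num :: "nat \<Rightarrow> 'h pair_pre_digraph \<Rightarrow> 'f pair_pre_digraph set \<Rightarrow> nat" where
  "ex_num n H \<F> =
     Max (insert 0 {card (copies H G) | G :: nat pair_pre_digraph.
                      pair_graph G \<and> card (pverts G) = n \<and> family_free \<F> G})"

text \<open>
  In \<open>glued_copies H R q\<close>, the graph \<open>H\<^sub>R\<^sup>q\<close>, a vertex \<open>v \<in> R\<close> becomes the single shared vertex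
  \<open>Inl v\<close>, and \<open>Inr (v, i)\<close> is the vertex corresponding to \<open>v \<notin> R\<close> in the \<open>i\<close>-th copy.
\<close>

definition copy_vertex :: "'a set \<Rightarrow> nat \<Rightarrow> 'a \<Rightarrow> 'a + 'a \<times> nat" where
  "copy_vertex R i v = (if v \<in> R then Inl v else Inr (v, i))"

definition glued_copies ::
    "'a pair_pre_digraph \<Rightarrow> 'a set \<Rightarrow> nat \<Rightarrow> ('a + 'a \<times> nat) pair_pre_digraph" where
  "glued_copies H R q =
     \<lparr> pverts = (\<Union>i<q. copy_vertex R i ` pverts H),
       parcs = (\<Union>i<q. map_prod (copy_vertex R i) (copy_vertex R i) ` parcs H) \<rparr>"

text \<open>
  Since the arcs of a graph are symmetric, its connected components are the strongly connected
  components of the underlying digraph.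
\<close>

definition num_components_minus :: "'a pair_pre_digraph \<Rightarrow> 'a set \<Rightarrow> nat" where
  "num_components_minus H R = card (pre_digraph.sccs (with_proj H \<restriction> (pverts H - R)))"

definition glued_family ::
    "'a pair_pre_digraph \<Rightarrow> nat \<Rightarrow> nat \<Rightarrow> ('a + 'a \<times> nat) pair_pre_digraph set" where
  "glued_family H k q =
     {glued_copies H R q | R. R \<subset> pverts H \<and> num_components_minus H R \<ge> k}"

end

theory Submission
  imports Defs
begin

text \<open>
  Suppose that for every \<open>q\<close> some \<open>\<F>\<close>-free graph contains a member of \<open>\<F>\<^sub>H\<^sub>,\<^sub>k\<^sup>q\<close>. Given \<open>n\<close>, take such
  a graph containing \<open>H\<^sub>R\<^sup>n\<close>, which has at least \<open>n\<close> vertices, and restrict it to \<open>n\<close> vertices including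
  those of \<open>H\<^sub>R\<^sup>q\<close> for \<open>q = n div card V(H)\<close>; adding isolated vertices to \<open>H\<^sub>R\<^sup>q\<close> instead could
  destroy \<open>\<F>\<close>-freeness. Choosing for every component of \<open>H - R\<close> independently one of the \<open>q\<close>
  copies it is taken from yields at least \<open>q ^ k\<close> copies of \<open>H\<close>.
\<close>

section \<open>Copies as injective images of vertex maps\<close>

text \<open>Arcs are pairs of endpoints, so a vertex map already determines its arc map. This lets
  the rest of the proof avoid isomorphism records; it is used for \<open>f\<close> injective on the
  vertices.\<close>

definition image_graph :: "('a \<Rightarrow> 'b) \<Rightarrow> 'a pair_pre_digraph \<Rightarrow> 'b pair_pre_digraph" where
  "image_graph f H = \<lparr> pverts = f ` pverts H, parcs = map_prod f f ` parcs H \<rparr>"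

lemma image_graph_simps [simp]:
  "pverts (image_graph f H) = f ` pverts H"
  "parcs (image_graph f H) = map_prod f f ` parcs H"
  by (simp_all add: image_graph_def)

lemma pair_graph_iff:
  "pair_graph G \<longleftrightarrow> finite (pverts G) \<and> parcs G \<subseteq> pverts G \<times> pverts G \<and> sym (parcs G) \<and> irrefl (parcs G)"
  (is "?L \<longleftrightarrow> ?R")
proof
  assume ?L
  then interpret pair_graph G .
  show ?R
    using pair_finite_verts arc_fst_in_verts arc_snd_in_verts arcs_symmetric pair_no_loops
    by (fastforce intro: symI irreflI)
next
  assume R: ?R
  then have "finite (parcs G)"
    by (meson finite_SigmaI finite_subset)
  with R show ?L
    by unfold_locales (auto simp: symmetric_def irrefl_def)
qed

lemma pair_graph_image_graph:
  assumes "pair_graph H" "inj_on f (pverts H)"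
  shows "pair_graph (image_graph f H)"
  using assms unfolding pair_graph_iff
  by (auto simp: sym_def irrefl_def inj_on_def map_prod_def image_iff) force+

lemma subgraph_with_proj_iff:
  "subgraph (with_proj K) (with_proj G) \<longleftrightarrow>
     pverts K \<subseteq> pverts G \<and> parcs K \<subseteq> parcs G \<and> pair_wf_digraph G \<and> pair_wf_digraph K"
  by (auto simp: subgraph_def wf_digraph_wp_iff)

text \<open>An isomorphism commutes with tails and heads, which are \<open>fst\<close> and
  \<open>snd\<close> on both sides; this forces its arc map to be \<open>map_prod f f\<close> for
  its vertex map \<open>f\<close>.\<close>

lemma copiesE:
  assumes "K \<in> copies H G"
  obtains f where "inj_on f (pverts H)" "K = image_graph f H"
    "pverts K \<subseteq> pverts G" "parcs K \<subseteq> parcs G"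
proof -
  from assms obtain h
    where h: "pre_digraph.digraph_isomorphism (with_proj H) h" "with_proj K = app_iso h (with_proj H)"
    by (auto simp: copies_def digraph_iso_def)
  let ?f = "iso_verts h"
  have V: "pverts K = ?f ` pverts H" and E: "parcs K = iso_arcs h ` parcs H"
    and T: "iso_tail h = fst" "iso_head h = snd"
    using h(2) by (simp_all add: with_proj_def app_iso_def)
  have "iso_arcs h e = map_prod ?f ?f e" if "e \<in> parcs H" for e
    using h(1) that unfolding pre_digraph.digraph_isomorphism_def
    by (simp add: T prod_eq_iff)
  with E have "parcs K = map_prod ?f ?f ` parcs H"
    by (metis (no_types, lifting) image_cong)
  with V have "K = image_graph ?f H"
    by (simp add: image_graph_def)
  moreover have "inj_on ?f (pverts H)"
    using h(1) by (simp add: pre_digraph.digraph_isomorphism_def)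
  ultimately show ?thesis
    using that assms by (auto simp: copies_def subgraph_with_proj_iff)
qed

text \<open>Converse of \<open>copiesE\<close>: \<open>f\<close> and \<open>map_prod f f\<close> are
  assembled into an isomorphism record, the arc map inheriting injectivity from
  \<open>f\<close>.\<close>

lemma image_graph_in_copies:
  assumes "pair_graph H" "pair_graph G" "inj_on f (pverts H)"
    and "f ` pverts H \<subseteq> pverts G" "map_prod f f ` parcs H \<subseteq> parcs G"
  shows "image_graph f H \<in> copies H G"
proof -
  have K: "pair_graph (image_graph f H)"
    using assms by (simp add: pair_graph_image_graph)
  have wf: "pair_wf_digraph H'" if "pair_graph H'" for H' :: "'c pair_pre_digraph"
    using that by (simp add: pair_graph_def pair_digraph_def pair_fin_digraph_def)
  have arcs: "parcs H \<subseteq> pverts H \<times> pverts H"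
    using assms(1) by (simp add: pair_graph_iff)
  let ?h = "\<lparr> iso_verts = f, iso_arcs = map_prod f f, iso_head = snd, iso_tail = fst \<rparr>"
  have "inj_on (map_prod f f) (parcs H)"
    using map_prod_inj_on[OF assms(3) assms(3)] arcs by (rule inj_on_subset)
  then have "pre_digraph.digraph_isomorphism (with_proj H) ?h"
    using assms(1,3) by (simp add: pre_digraph.digraph_isomorphism_def wf_digraph_wp_iff wf)
  moreover have "with_proj (image_graph f H) = app_iso ?h (with_proj H)"
    by (simp add: with_proj_def app_iso_def)
  ultimately have "digraph_iso (with_proj H) (with_proj (image_graph f H))"
    unfolding digraph_iso_def by blast
  then show ?thesis
    using K assms wf[OF K] wf[OF assms(2)] by (simp add: copies_def subgraph_with_proj_iff)
qed

section \<open>Monotonicity and finiteness of the counts\<close>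

lemma copies_mono:
  assumes "pair_graph G" "pverts G' \<subseteq> pverts G" "parcs G' \<subseteq> parcs G"
  shows "copies H G' \<subseteq> copies H G"
  using assms
  by (auto simp: copies_def subgraph_with_proj_iff pair_graph_def pair_digraph_def pair_fin_digraph_def)

lemma family_free_antimono:
  assumes "family_free \<F> G" "pair_graph G" "pverts G' \<subseteq> pverts G" "parcs G' \<subseteq> parcs G"
  shows "family_free \<F> G'"
  using assms copies_mono[OF assms(2-4)] unfolding family_free_def by blast

text \<open>A copy is determined by its vertex set and its arc set, subsets of \<open>V\<close> and
  \<open>V \<times> V\<close>. The bound depends on \<open>n\<close> alone, which makes the maximum
  in \<open>ex_num\<close> range over a finite set.\<close>

lemma copies_finite_card:
  assumes "pair_graph G" "card (pverts G) = n"
  shows "finite (copies H G)" "card (copies H G) \<le> 2 ^ n * 2 ^ (n * n)"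
proof -
  let ?V = "pverts G"
  let ?S = "Pow ?V \<times> Pow (?V \<times> ?V)"
  have fin: "finite ?V" and sub: "parcs G \<subseteq> ?V \<times> ?V"
    using assms(1) by (auto simp: pair_graph_iff)
  have inj: "inj_on (\<lambda>K. (pverts K, parcs K)) (copies H G)"
    by (auto intro!: inj_onI)
  have img: "(\<lambda>K. (pverts K, parcs K)) ` copies H G \<subseteq> ?S"
  proof (rule image_subsetI)
    fix K assume "K \<in> copies H G"
    then have "pverts K \<subseteq> ?V" "parcs K \<subseteq> ?V \<times> ?V"
      using sub copiesE[of K H G] by (meson order.trans)+
    then show "(pverts K, parcs K) \<in> ?S"
      by simp
  qed
  have finS: "finite ?S"
    using fin by simp
  show "finite (copies H G)"
    using inj_on_finite[OF inj img finS] .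
  have "card (copies H G) \<le> card ?S"
    using card_inj_on_le[OF inj img finS] .
  then show "card (copies H G) \<le> 2 ^ n * 2 ^ (n * n)"
    using fin assms(2) by (simp add: card_Pow card_cartesian_product)
qed

lemma finite_copy_counts:
  "finite {card (copies H G) | G :: nat pair_pre_digraph.
     pair_graph G \<and> card (pverts G) = n \<and> family_free \<F> G}"
  by (rule finite_subset[of _ "{..2 ^ n * 2 ^ (n * n)}"]) (auto intro: copies_finite_card(2))

lemma ex_num_ge:
  fixes G :: "nat pair_pre_digraph"
  assumes "pair_graph G" "card (pverts G) = n" "family_free \<F> G"
  shows "card (copies H G) \<le> ex_num n H \<F>"
  unfolding ex_num_def using assms finite_copy_counts
  by (intro Max_ge) auto

lemma ex_num_mono:
  assumes "\<And>G :: nat pair_pre_digraph. pair_graph G \<Longrightarrow> family_free \<F> G \<Longrightarrow> family_free \<G> G"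
  shows "ex_num n H \<F> \<le> ex_num n H \<G>"
  unfolding ex_num_def using assms finite_copy_counts
  by (intro Max_mono) auto

section \<open>The glued graphs\<close>

text \<open>For \<open>q = 0\<close> the defining union is empty, so even the shared vertices are
  missing.\<close>

lemma pverts_glued_copies:
  "q > 0 \<Longrightarrow> pverts (glued_copies H R q) = Inl ` (pverts H \<inter> R) \<union> Inr ` ((pverts H - R) \<times> {..<q})"
  by (auto simp: glued_copies_def copy_vertex_def image_iff split: if_splits)

lemma glued_copies_mono:
  assumes "p \<le> q"
  shows "pverts (glued_copies H R p) \<subseteq> pverts (glued_copies H R q)"
    and "parcs (glued_copies H R p) \<subseteq> parcs (glued_copies H R q)"
proof -
  have "{..<p} \<subseteq> {..<q}"
    using assms by auto
  then show "pverts (glued_copies H R p) \<subseteq> pverts (glued_copies H R q)"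
    and "parcs (glued_copies H R p) \<subseteq> parcs (glued_copies H R q)"
    unfolding glued_copies_def by (simp_all add: UN_mono)
qed

lemma card_glued_copies_le:
  assumes "finite (pverts H)"
  shows "card (pverts (glued_copies H R q)) \<le> q * card (pverts H)"
proof -
  have "card (pverts (glued_copies H R q)) \<le> (\<Sum>i<q. card (copy_vertex R i ` pverts H))"
    unfolding glued_copies_def by (simp add: card_UN_le)
  also have "\<dots> \<le> (\<Sum>i<q. card (pverts H))"
    using assms by (intro sum_mono card_image_le)
  finally show ?thesis
    by simp
qed

text \<open>A single vertex outside \<open>R\<close> already contributes \<open>q\<close> distinct
  vertices, one per copy.\<close>

lemma card_glued_copies_ge:
  assumes "finite (pverts H)" "R \<subset> pverts H"
  shows "q \<le> card (pverts (glued_copies H R q))"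
proof (cases "q = 0")
  case False
  obtain v where v: "v \<in> pverts H" "v \<notin> R"
    using assms(2) by auto
  have "finite (pverts (glued_copies H R q))"
    using assms(1) by (simp add: glued_copies_def)
  moreover have "(\<lambda>i. Inr (v, i)) ` {..<q} \<subseteq> pverts (glued_copies H R q)"
    using v False by (auto simp: pverts_glued_copies)
  ultimately have "card ((\<lambda>i. Inr (v, i) :: 'a + 'a \<times> nat) ` {..<q}) \<le> card (pverts (glued_copies H R q))"
    by (rule card_mono)
  then show ?thesis
    by (simp add: card_image inj_on_def)
qed simp

section \<open>Mixing the copies component by component\<close>

text \<open>Labels each vertex of \<open>H - R\<close> by the vertex set of its component. The
  counting argument needs only the number of labels and their constancy along edges.\<close>

lemma components_labelling:
  assumes "pair_graph H"
  obtains comp :: "'a \<Rightarrow> 'a set"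
    where "card (comp ` (pverts H - R)) = num_components_minus H R"
      "\<And>u v. (u, v) \<in> parcs H \<Longrightarrow> u \<notin> R \<Longrightarrow> v \<notin> R \<Longrightarrow> comp u = comp v"
proof -
  interpret pair_graph H by fact
  let ?D = "with_proj H \<restriction> (pverts H - R)"
  interpret D: wf_digraph ?D
    by (rule wellformed_induce_subgraph)
  have "card (D.scc_of ` (pverts H - R)) = num_components_minus H R"
    by (metis D.card_sccs_verts D.sccs_verts_conv_scc_of induce_subgraph_verts num_components_minus_def)
  moreover have "D.scc_of u = D.scc_of v" if "(u, v) \<in> parcs H" "u \<notin> R" "v \<notin> R" for u v
  proof -
    have dom: "x \<rightarrow>\<^bsub>?D\<^esub> y" if "(x, y) \<in> parcs H" "x \<notin> R" "y \<notin> R" for x y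
      using that in_arcsD1 in_arcsD2
      by (force simp: arcs_ends_conv image_iff)
    \<comment> \<open>Symmetry of the arcs gives both directions, so adjacent vertices are strongly
      connected.\<close>
    have "u \<rightarrow>\<^bsub>?D\<^esub> v" "v \<rightarrow>\<^bsub>?D\<^esub> u"
      using that dom arcs_symmetric by auto
    then have "u \<in> D.scc_of v"
      by (simp add: D.scc_of_def)
    then show ?thesis
      by (rule D.scc_of_eq)
  qed
  ultimately show thesis
    by (rule that)
qed

text \<open>A function \<phi> assigns to every component the index of the copy it is taken from.
  Each choice embeds \<open>H\<close>, and different choices give different vertex sets.\<close>

lemma card_copies_glued_ge:
  assumes H: "pair_graph H" and G: "pair_graph G" and "q > 0"
    and f: "inj_on f (pverts (glued_copies H R q))"
    and V: "f ` pverts (glued_copies H R q) \<subseteq> pverts G"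
    and E: "map_prod f f ` parcs (glued_copies H R q) \<subseteq> parcs G"
  shows "q ^ num_components_minus H R \<le> card (copies H G)"
proof -
  obtain comp :: "'a \<Rightarrow> 'a set" where card_C: "card (comp ` (pverts H - R)) = num_components_minus H R"
    and comp: "\<And>u v. (u, v) \<in> parcs H \<Longrightarrow> u \<notin> R \<Longrightarrow> v \<notin> R \<Longrightarrow> comp u = comp v"
    using components_labelling[OF H, of R] by blast
  define C where "C = comp ` (pverts H - R)"
  have finC: "finite C" and arcsH: "parcs H \<subseteq> pverts H \<times> pverts H"
    using H by (auto simp: C_def pair_graph_iff)
  define g where "g \<phi> v = copy_vertex R (\<phi> (comp v)) v" for \<phi> :: "'a set \<Rightarrow> nat" and v
  \<comment> \<open>Extensional functions are fixed by their values on \<open>C\<close>, so there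
    are exactly \<open>q ^ card C\<close> of them.\<close>
  let ?P = "PiE C (\<lambda>_. {..<q})"
  let ?K = "\<lambda>\<phi>. image_graph (f \<circ> g \<phi>) H"
  have inP: "\<phi> (comp v) < q" if "\<phi> \<in> ?P" "v \<in> pverts H" "v \<notin> R" for \<phi> v
    using that by (auto simp: C_def dest!: PiE_mem[of _ _ _ "comp v"])
  have gV: "g \<phi> ` pverts H \<subseteq> pverts (glued_copies H R q)" if "\<phi> \<in> ?P" for \<phi>
    using that inP \<open>q > 0\<close> by (auto simp: pverts_glued_copies g_def copy_vertex_def)
  have gE: "map_prod (g \<phi>) (g \<phi>) e \<in> parcs (glued_copies H R q)"
    if \<phi>: "\<phi> \<in> ?P" and e: "e \<in> parcs H" for \<phi> e
  proof -
    obtain u v where uv: "e = (u, v)" "u \<in> pverts H" "v \<in> pverts H"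
      using e arcsH by auto
    \<comment> \<open>Every edge stays within one copy: an endpoint outside \<open>R\<close>
      dictates the index, two such endpoints carry the same label, and for two endpoints in
      \<open>R\<close> any index serves, \<open>0\<close> being available as
      \<open>q > 0\<close>.\<close>
    obtain i where "i < q" "g \<phi> u = copy_vertex R i u" "g \<phi> v = copy_vertex R i v"
    proof (cases "u \<in> R")
      case True
      show ?thesis
      proof (cases "v \<in> R")
        case True
        with \<open>u \<in> R\<close> \<open>q > 0\<close> show ?thesis
          by (intro that[of 0]) (auto simp: g_def copy_vertex_def)
      next
        case False
        with \<open>u \<in> R\<close> inP[OF \<phi> uv(3)] show ?thesis
          by (intro that[of "\<phi> (comp v)"]) (auto simp: g_def copy_vertex_def)
      qed
    next
      case False
      with inP[OF \<phi> uv(2)] comp[of u v] e uv(1) show ?thesis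
        by (intro that[of "\<phi> (comp u)"]) (auto simp: g_def copy_vertex_def)
    qed
    then show ?thesis
      using e uv(1) by (force simp: glued_copies_def)
  qed
  have inj_g: "inj_on (g \<phi>) (pverts H)" for \<phi>
    by (auto simp: inj_on_def g_def copy_vertex_def split: if_splits)
  have "?K \<phi> \<in> copies H G" if "\<phi> \<in> ?P" for \<phi>
  proof (rule image_graph_in_copies[OF H G])
    show "inj_on (f \<circ> g \<phi>) (pverts H)"
      using inj_g gV[OF that] f by (blast intro: comp_inj_on inj_on_subset)
    show "(f \<circ> g \<phi>) ` pverts H \<subseteq> pverts G"
      using gV[OF that] V by fastforce
    show "map_prod (f \<circ> g \<phi>) (f \<circ> g \<phi>) ` parcs H \<subseteq> parcs G"
    proof
      fix e' assume "e' \<in> map_prod (f \<circ> g \<phi>) (f \<circ> g \<phi>) ` parcs H"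
      then obtain e where "e \<in> parcs H" "e' = map_prod f f (map_prod (g \<phi>) (g \<phi>) e)"
        by (auto simp: map_prod_def split_beta)
      then show "e' \<in> parcs G"
        using gE[OF that] E by blast
    qed
  qed
  then have img: "?K ` ?P \<subseteq> copies H G"
    by blast
  have "inj_on ?K ?P"
  proof (rule inj_onI)
    fix \<phi> \<psi> assume \<phi>: "\<phi> \<in> ?P" and \<psi>: "\<psi> \<in> ?P" and eq: "?K \<phi> = ?K \<psi>"
    have "f ` g \<phi> ` pverts H = f ` g \<psi> ` pverts H"
      using arg_cong[OF eq, of pverts] by (simp add: image_comp)
    then have eq': "g \<phi> ` pverts H = g \<psi> ` pverts H"
      using inj_on_image_eq_iff[OF f gV[OF \<phi>] gV[OF \<psi>]] by simp
    have "\<phi> c = \<psi> c" if c: "c \<in> C" for c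
    proof -
      obtain v where v: "v \<in> pverts H" "v \<notin> R" "c = comp v"
        using c by (auto simp: C_def)
      \<comment> \<open>The vertex set contains \<open>v\<close> in exactly one copy, so it reveals
        the index chosen for the component of \<open>v\<close>.\<close>
      then have "Inr (v, \<phi> c) \<in> g \<phi> ` pverts H"
        by (force simp: g_def copy_vertex_def)
      then have "Inr (v, \<phi> c) \<in> g \<psi> ` pverts H"
        by (simp add: eq')
      then show ?thesis
        using v by (auto simp: g_def copy_vertex_def split: if_splits)
    qed
    then show "\<phi> = \<psi>"
      using PiE_ext[OF \<phi> \<psi>] by blast
  qed
  then have "card ?P \<le> card (copies H G)"
    using img copies_finite_card(1)[OF G refl] by (rule card_inj_on_le)
  then show ?thesis
    using finC card_C by (simp add: card_PiE C_def)
qed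

section \<open>The lower bound and its constant\<close>

lemma ex_num_ge_power:
  fixes H :: "'a pair_pre_digraph" and G :: "nat pair_pre_digraph"
  assumes H: "pair_graph H" and G: "pair_graph G" "family_free \<F> G"
    and not_free: "\<not> family_free (glued_family H k n) G"
    and n: "card (pverts H) \<le> n"
  shows "(n div card (pverts H)) ^ k \<le> ex_num n H \<F>"
proof -
  have finH: "finite (pverts H)"
    using H by (simp add: pair_graph_iff)
  obtain R K where R: "R \<subset> pverts H" "k \<le> num_components_minus H R"
    and "K \<in> copies (glued_copies H R n) G"
    using not_free by (auto simp: family_free_def glued_family_def)
  then obtain f where f: "inj_on f (pverts (glued_copies H R n))"
    and fV: "f ` pverts (glued_copies H R n) \<subseteq> pverts G"
    and fE: "map_prod f f ` parcs (glued_copies H R n) \<subseteq> parcs G"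
    by (metis copiesE image_graph_simps)
  define h where "h = card (pverts H)"
  \<comment> \<open>The largest \<open>q\<close> with \<open>q * h \<le> n\<close>, so that
    \<open>q\<close> glued copies fit into \<open>n\<close> vertices.\<close>
  define q where "q = n div h"
  have "h > 0"
    using R(1) finH by (auto simp: h_def card_gt_0_iff)
  then have "q > 0" "q \<le> n"
    using n by (simp_all add: q_def h_def div_greater_zero_iff)
  have finG: "finite (pverts G)"
    using G(1) by (simp add: pair_graph_iff)
  have mono: "pverts (glued_copies H R q) \<subseteq> pverts (glued_copies H R n)"
    "parcs (glued_copies H R q) \<subseteq> parcs (glued_copies H R n)"
    using glued_copies_mono[OF \<open>q \<le> n\<close>] by blast+
  let ?W = "f ` pverts (glued_copies H R q)"
  have "card ?W \<le> card (pverts (glued_copies H R q))"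
    using finH by (intro card_image_le) (simp add: glued_copies_def)
  also have "\<dots> \<le> q * h"
    using finH unfolding h_def by (rule card_glued_copies_le)
  finally have W: "card ?W \<le> n"
    by (simp add: q_def) (meson div_times_less_eq_dividend le_trans)
  have "n \<le> card (pverts (glued_copies H R n))"
    using finH R(1) by (rule card_glued_copies_ge)
  also have "\<dots> \<le> card (pverts G)"
    using f fV finG by (rule card_inj_on_le)
  \<comment> \<open>There is room for \<open>S\<close>: the \<open>q\<close> copies occupy at most
    \<open>n\<close> vertices, while the \<open>n\<close> copies force \<open>G\<close> to have at
    least \<open>n\<close>.\<close>
  finally obtain S where S: "?W \<subseteq> S" "S \<subseteq> pverts G" "card S = n"
    using exists_subset_between[OF W _ _ finG] fV mono(1) by blast
  \<comment> \<open>The induced subgraph keeps all arcs of the \<open>q\<close> copies and inherits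
    \<open>\<F>\<close>-freeness from \<open>G\<close>.\<close>
  define G' where "G' = \<lparr> pverts = S, parcs = parcs G \<inter> S \<times> S \<rparr>"
  have G': "pair_graph G'"
    using G(1) S(2) finG unfolding pair_graph_iff G'_def
    by (auto simp: sym_def irrefl_def intro: finite_subset)
  have "q ^ num_components_minus H R \<le> card (copies H G')"
  proof (rule card_copies_glued_ge[OF H G' \<open>q > 0\<close>])
    show "inj_on f (pverts (glued_copies H R q))"
      using f mono(1) by (rule inj_on_subset)
    show "?W \<subseteq> pverts G'"
      using S(1) by (simp add: G'_def)
    have "parcs (glued_copies H R q) \<subseteq> pverts (glued_copies H R q) \<times> pverts (glued_copies H R q)"
      using H unfolding glued_copies_def pair_graph_iff by fastforce
    then show "map_prod f f ` parcs (glued_copies H R q) \<subseteq> parcs G'"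
      using S(1) fE mono(2) unfolding G'_def by fastforce
  qed
  moreover have "q ^ k \<le> q ^ num_components_minus H R"
    using \<open>q > 0\<close> R(2) by (simp add: power_increasing)
  moreover have "card (copies H G') \<le> ex_num n H \<F>"
    using G' S family_free_antimono[OF G(2,1)] by (intro ex_num_ge) (auto simp: G'_def)
  ultimately show ?thesis
    by (simp add: q_def h_def)
qed

text \<open>The quotient is at least 1, so the remainder is below \<open>h * (n div h)\<close>:
  rounding down loses at most a factor 2.\<close>

lemma half_quotient_le_div:
  fixes n h :: nat
  assumes "0 < h" "h \<le> n"
  shows "real n / (2 * real h) \<le> real (n div h)"
proof -
  have "n = h * (n div h) + n mod h" "n mod h < h"
    using assms by simp_all
  moreover have "h * 1 \<le> h * (n div h)"
    using assms by (intro mult_le_mono2) (simp add: Suc_le_eq div_greater_zero_iff)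
  ultimately have "n \<le> 2 * (h * (n div h))"
    by linarith
  then have "real n \<le> real (2 * (h * (n div h)))"
    by (rule of_nat_mono)
  then show ?thesis
    using assms by (simp add: field_simps)
qed

theorem proposition5p1:
  fixes H :: "'a pair_pre_digraph" and k :: nat
  assumes "pair_graph H" and "k \<ge> 1"
  shows "\<exists>c::real. c > 0 \<and> (\<exists>n\<^sub>0::nat.
    \<forall>\<F> :: nat pair_pre_digraph set. (\<forall>F\<in>\<F>. pair_graph F) \<longrightarrow>
      ((\<forall>n\<ge>n\<^sub>0. real (ex_num n H \<F>) \<ge> c * real n ^ k) \<or>
       (\<exists>q::nat. q > 0 \<and>
          (\<forall>G :: nat pair_pre_digraph.
             pair_graph G \<and> family_free \<F> G \<longrightarrow> family_free (glued_family H k q) G))) \<and>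
      ((\<forall>n\<ge>n\<^sub>0. real (ex_num n H \<F>) \<ge> c * real n ^ k) \<or>
       (\<exists>q::nat. q > 0 \<and>
          (\<forall>n. ex_num n H \<F> \<le> ex_num n H (glued_family H k q)))))"
proof -
  \<comment> \<open>The null graph has no proper subsets \<open>R\<close>, so the \<open>max\<close> only serves to make \<open>c\<close> positive.\<close>
  define h where "h = max 1 (card (pverts H))"
  \<comment> \<open>The factor from \<open>half_quotient_le_div\<close>, raised to the power
    \<open>k\<close>; like the threshold \<open>h\<close>, it is fixed before
    \<open>\<F>\<close>.\<close>
  define c where "c = (1 / (2 * real h)) ^ k"
  have "c > 0"
    by (simp add: c_def h_def)
  have main: "(\<forall>n\<ge>h. real (ex_num n H \<F>) \<ge> c * real n ^ k) \<or>
      (\<exists>q>0. \<forall>G :: nat pair_pre_digraph.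
         pair_graph G \<and> family_free \<F> G \<longrightarrow> family_free (glued_family H k q) G)"
    for \<F> :: "nat pair_pre_digraph set"
  proof (rule disjCI)
    assume *: "\<not> (\<exists>q>0. \<forall>G :: nat pair_pre_digraph.
       pair_graph G \<and> family_free \<F> G \<longrightarrow> family_free (glued_family H k q) G)"
    show "\<forall>n\<ge>h. real (ex_num n H \<F>) \<ge> c * real n ^ k"
    proof (intro allI impI)
      fix n assume n: "h \<le> n"
      then have "n > 0"
        by (simp add: h_def)
      \<comment> \<open>The failing alternative is used at \<open>q = n\<close>, which must be
        positive.\<close>
      then obtain G :: "nat pair_pre_digraph" where G: "pair_graph G" "family_free \<F> G"
        and not_free: "\<not> family_free (glued_family H k n) G"
        using * by blast
      have "pverts H \<noteq> {}"
        using not_free by (auto simp: family_free_def glued_family_def)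
      then have h: "h = card (pverts H)" "h > 0"
        using assms(1) by (auto simp: h_def pair_graph_iff card_gt_0_iff Suc_le_eq max_def)
      have "c * real n ^ k = (real n / (2 * real h)) ^ k"
        by (simp add: c_def power_divide)
      also have "\<dots> \<le> real (n div h) ^ k"
        using half_quotient_le_div[OF h(2) n] by (rule power_mono) simp
      also have "\<dots> = real ((n div h) ^ k)"
        by simp
      also have "\<dots> \<le> real (ex_num n H \<F>)"
        using ex_num_ge_power[OF assms(1) G not_free] n h(1) by (intro of_nat_mono) simp
      finally show "c * real n ^ k \<le> real (ex_num n H \<F>)" .
    qed
  qed
  show ?thesis
  proof (intro exI[of _ c] exI[of _ h] conjI allI impI)
    show "c > 0" by fact
  next
    fix \<F> :: "nat pair_pre_digraph set"
    show "(\<forall>n\<ge>h. real (ex_num n H \<F>) \<ge> c * real n ^ k) \<or>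
      (\<exists>q>0. \<forall>G :: nat pair_pre_digraph.
         pair_graph G \<and> family_free \<F> G \<longrightarrow> family_free (glued_family H k q) G)"
      by (rule main)
    \<comment> \<open>The second dichotomy keeps the same \<open>q\<close>: if freeness passes from
      one family to another, the maximum is taken over a larger set.\<close>
    then show "(\<forall>n\<ge>h. real (ex_num n H \<F>) \<ge> c * real n ^ k) \<or>
      (\<exists>q>0. \<forall>n. ex_num n H \<F> \<le> ex_num n H (glued_family H k q))"
      by (meson ex_num_mono)
  qed
qed

end
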